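(* Every compact strictly zero-dimensional biframe is (isomorphic to) the congruence biframe $\mathbb{C}N$ of a Noetherian frame $N$.
   Context: A biframe is a triple $M=(M_0,M_1,M_2)$ where $M_0$ is a frame (the total part) and $M_1,M_2$ are subframes of $M_0$ whose union generates $M_0$. A biframe homomorphism $M\to N$ is a frame homomorphism $M_0\to N_0$ mapping $M_i$ into $N_i$ for $i=1,2$. A biframe is compact if its total part is a compact frame (the top element is compact). A biframe $M$ is strictly zero-dimensional if every $a\in M_1$ is complemented in $M_0$ with its complement lying in $M_2$, and these complements generate $M_2$. A frame is Noetherian if all of its elements are compact. For a frame $L$, let $\mathbb{C}L$ also denote the frame of all frame congruences on $L$ ordered by inclusion (a congruence is an equivalence relation closed under finite meets and arbitrary joins in $L\times L$). For $a\in L$ let $\nabla_a=\langle(0,a)\rangle$ and $\Delta_a=\langle(a,1)\rangle$ be the congruences generated by the indicated pairs. The congruence biframe is $\mathbb{C}L=(\mathbb{C}L,\nabla L,\Delta L)$ where $\nabla L=\{\nabla_a\mid a\in L\}$ and $\Delta L$ is the subframe generated by $\{\Delta_a\mid a\in L\}$. *)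

theory Defs
  imports "HOL-Algebra.Complete_Lattice"
begin

section \<open>Frames\<close>

locale frame = complete_lattice L for L (structure) +
  assumes meet_sup_distrib:
    "\<lbrakk>a \<in> carrier L; B \<subseteq> carrier L\<rbrakk> \<Longrightarrow> a \<sqinter> (\<Squnion>B) = \<Squnion>((\<lambda>b. a \<sqinter> b) ` B)"

text \<open>The least element needs no clause of its own below: it is the join of the empty set.\<close>

definition subframe :: "'a set \<Rightarrow> 'a gorder \<Rightarrow> bool" where
  "subframe S L \<longleftrightarrow>
     S \<subseteq> carrier L \<and> \<top>\<^bsub>L\<^esub> \<in> S \<and>
     (\<forall>a\<in>S. \<forall>b\<in>S. a \<sqinter>\<^bsub>L\<^esub> b \<in> S) \<and>
     (\<forall>A\<subseteq>S. \<Squnion>\<^bsub>L\<^esub>A \<in> S)"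

definition generated_subframe :: "'a gorder \<Rightarrow> 'a set \<Rightarrow> 'a set" where
  "generated_subframe L A = \<Inter>{S. subframe S L \<and> A \<subseteq> S}"

definition frame_hom :: "'a gorder \<Rightarrow> 'b gorder \<Rightarrow> ('a \<Rightarrow> 'b) \<Rightarrow> bool" where
  "frame_hom L K f \<longleftrightarrow>
     frame L \<and> frame K \<and>
     f \<in> carrier L \<rightarrow> carrier K \<and>
     f \<top>\<^bsub>L\<^esub> = \<top>\<^bsub>K\<^esub> \<and>
     (\<forall>a\<in>carrier L. \<forall>b\<in>carrier L. f (a \<sqinter>\<^bsub>L\<^esub> b) = f a \<sqinter>\<^bsub>K\<^esub> f b) \<and>
     (\<forall>A\<subseteq>carrier L. f (\<Squnion>\<^bsub>L\<^esub>A) = \<Squnion>\<^bsub>K\<^esub>(f ` A))"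

definition compact_element :: "'a gorder \<Rightarrow> 'a \<Rightarrow> bool" where
  "compact_element L a \<longleftrightarrow>
     a \<in> carrier L \<and>
     (\<forall>A\<subseteq>carrier L. a \<sqsubseteq>\<^bsub>L\<^esub> \<Squnion>\<^bsub>L\<^esub>A \<longrightarrow> (\<exists>F\<subseteq>A. finite F \<and> a \<sqsubseteq>\<^bsub>L\<^esub> \<Squnion>\<^bsub>L\<^esub>F))"

definition compact_frame :: "'a gorder \<Rightarrow> bool" where
  "compact_frame L \<longleftrightarrow> frame L \<and> compact_element L \<top>\<^bsub>L\<^esub>"

definition noetherian_frame :: "'a gorder \<Rightarrow> bool" where
  "noetherian_frame L \<longleftrightarrow> frame L \<and> (\<forall>a\<in>carrier L. compact_element L a)"

definition is_complement :: "'a gorder \<Rightarrow> 'a \<Rightarrow> 'a \<Rightarrow> bool" where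
  "is_complement L a b \<longleftrightarrow>
     a \<in> carrier L \<and> b \<in> carrier L \<and>
     a \<sqinter>\<^bsub>L\<^esub> b = \<bottom>\<^bsub>L\<^esub> \<and> a \<squnion>\<^bsub>L\<^esub> b = \<top>\<^bsub>L\<^esub>"


section \<open>Biframes\<close>

record 'a biframe_data =
  total_part :: "'a gorder"
  first_part :: "'a set"
  second_part :: "'a set"

definition biframe :: "'a biframe_data \<Rightarrow> bool" where
  "biframe M \<longleftrightarrow>
     frame (total_part M) \<and>
     subframe (first_part M) (total_part M) \<and>
     subframe (second_part M) (total_part M) \<and>
     generated_subframe (total_part M) (first_part M \<union> second_part M)
       = carrier (total_part M)"

definition biframe_hom :: "'a biframe_data \<Rightarrow> 'b biframe_data \<Rightarrow> ('a \<Rightarrow> 'b) \<Rightarrow> bool" where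
  "biframe_hom M N f \<longleftrightarrow>
     biframe M \<and> biframe N \<and>
     frame_hom (total_part M) (total_part N) f \<and>
     f ` first_part M \<subseteq> first_part N \<and>
     f ` second_part M \<subseteq> second_part N"

definition biframe_isomorphic :: "'a biframe_data \<Rightarrow> 'b biframe_data \<Rightarrow> bool" where
  "biframe_isomorphic M N \<longleftrightarrow>
     (\<exists>f g. biframe_hom M N f \<and> biframe_hom N M g \<and>
            (\<forall>x\<in>carrier (total_part M). g (f x) = x) \<and>
            (\<forall>y\<in>carrier (total_part N). f (g y) = y))"

definition compact_biframe :: "'a biframe_data \<Rightarrow> bool" where
  "compact_biframe M \<longleftrightarrow> biframe M \<and> compact_frame (total_part M)"

definition strictly_zero_dimensional :: "'a biframe_data \<Rightarrow> bool" where
  "strictly_zero_dimensional M \<longleftrightarrow>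
     biframe M \<and>
     (\<forall>a\<in>first_part M. \<exists>b\<in>second_part M. is_complement (total_part M) a b) \<and>
     second_part M =
       generated_subframe (total_part M)
         {b. \<exists>a\<in>first_part M. is_complement (total_part M) a b}"


section \<open>The congruence biframe\<close>

text \<open>
  Meets and joins in the product of \<^term>\<open>L\<close> with itself are componentwise; the top pair
  belongs to every such relation by reflexivity.
\<close>

definition frame_congruence :: "'a gorder \<Rightarrow> ('a \<times> 'a) set \<Rightarrow> bool" where
  "frame_congruence L \<theta> \<longleftrightarrow>
     equiv (carrier L) \<theta> \<and>
     (\<forall>(a, b)\<in>\<theta>. \<forall>(c, d)\<in>\<theta>. (a \<sqinter>\<^bsub>L\<^esub> c, b \<sqinter>\<^bsub>L\<^esub> d) \<in> \<theta>) \<and>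
     (\<forall>R\<subseteq>\<theta>. (\<Squnion>\<^bsub>L\<^esub>(fst ` R), \<Squnion>\<^bsub>L\<^esub>(snd ` R)) \<in> \<theta>)"

definition generated_congruence :: "'a gorder \<Rightarrow> ('a \<times> 'a) set \<Rightarrow> ('a \<times> 'a) set" where
  "generated_congruence L R = \<Inter>{\<theta>. frame_congruence L \<theta> \<and> R \<subseteq> \<theta>}"

definition nabla :: "'a gorder \<Rightarrow> 'a \<Rightarrow> ('a \<times> 'a) set" where
  "nabla L a = generated_congruence L {(\<bottom>\<^bsub>L\<^esub>, a)}"

definition delta :: "'a gorder \<Rightarrow> 'a \<Rightarrow> ('a \<times> 'a) set" where
  "delta L a = generated_congruence L {(a, \<top>\<^bsub>L\<^esub>)}"

definition congruence_frame :: "'a gorder \<Rightarrow> ('a \<times> 'a) set gorder" where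
  "congruence_frame L = \<lparr>carrier = {\<theta>. frame_congruence L \<theta>}, eq = (=), le = (\<subseteq>)\<rparr>"

definition congruence_biframe :: "'a gorder \<Rightarrow> ('a \<times> 'a) set biframe_data" where
  "congruence_biframe L =
     \<lparr>total_part = congruence_frame L,
      first_part = nabla L ` carrier L,
      second_part = generated_subframe (congruence_frame L) (delta L ` carrier L)\<rparr>"

end

theory Submission
  imports Defs
begin

text \<open>
  Let \<open>M\<close> be a compact strictly zero-dimensional biframe with total part \<open>L\<close> and first part \<open>S\<close>.
  The Noetherian frame is \<open>S\<close> itself: a complemented element of a compact frame is compact
  (\<open>complemented_imp_compact\<close>), and every element of \<open>S\<close> is complemented in \<open>L\<close>.

  An element \<open>x\<close> of \<open>L\<close> determines a congruence on \<open>S\<close>, namely the kernel of the frame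
  homomorphism \<open>a \<mapsto> a \<squnion> x\<close> from \<open>S\<close> to the upper segment above \<open>x\<close>. It identifies \<open>a\<close> and \<open>b\<close>
  when \<open>a \<sqsubseteq> b \<squnion> x\<close> and \<open>b \<sqsubseteq> a \<squnion> x\<close>. The isomorphism from \<open>L\<close> to the frame of
  congruences of \<open>S\<close> is \<open>x \<mapsto> kernel x\<close>. Everything rests on the equivalence of \<open>b \<sqinter> a' \<sqsubseteq> x\<close> and
  \<open>b \<sqsubseteq> a \<squnion> x\<close> for complementary \<open>a\<close> and \<open>a'\<close> (\<open>meet_complement_le_iff\<close>).

  \<^item> The map reflects the order (\<open>kernel_subset_iff\<close>): by strict zero-dimensionality each \<open>x\<close> is
    the join of the differences \<open>b \<sqinter> a'\<close> below it, with \<open>a\<close> and \<open>b\<close> in \<open>S\<close>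
    (\<open>sup_of_differences\<close>), and whether \<open>b \<sqinter> a' \<sqsubseteq> x\<close> holds can be read off from \<open>kernel x\<close>.

  \<^item> The map is surjective (\<open>kernel_sup_residual\<close>): a congruence \<open>\<theta>\<close> is the kernel of the join of
    all \<open>d \<sqinter> c'\<close> with \<open>(c, d) \<in> \<theta>\<close>. This is where compactness enters. If
    \<open>b \<sqsubseteq> a \<squnion> x\<close> for this join \<open>x\<close>, then finitely many pairs of \<open>\<theta>\<close> suffice, and these can be
    eliminated one at a time (\<open>congruence_of_le_finite_sup\<close>).

  The kernels of \<open>a \<in> S\<close> and of its complement are \<open>nabla a\<close> and \<open>delta a\<close>, so the two
  subframes correspond. That the congruences form a frame, and a biframe, is then transported
  along the order isomorphism (\<open>biframe_transport\<close>).
\<close>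

section \<open>Frames and subframes\<close>

lemma (in complete_lattice) sup_eqI:
  "least L s (Upper L A) \<Longrightarrow> \<Squnion>A = s"
  unfolding sup_def by (rule some_equality) (auto intro: least_unique)

lemma (in complete_lattice) inf_eqI:
  "greatest L s (Lower L A) \<Longrightarrow> \<Sqinter>A = s"
  unfolding inf_def by (rule some_equality) (auto intro: greatest_unique)

lemma (in complete_lattice) top_eqI:
  "greatest L s (carrier L) \<Longrightarrow> \<top> = s"
  unfolding top_def by (rule some_equality) (auto intro: greatest_unique)

lemma (in complete_lattice) bottom_eqI:
  "least L s (carrier L) \<Longrightarrow> \<bottom> = s"
  unfolding bottom_def by (rule some_equality) (auto intro: least_unique)

context frame
begin

lemma sup_empty_eq: "\<Squnion>{} = \<bottom>"
  using weak_sup_empty by (simp add: eq_is_equal)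

lemma sup_insert_eq:
  "\<lbrakk>a \<in> carrier L; A \<subseteq> carrier L\<rbrakk> \<Longrightarrow> \<Squnion>(insert a A) = a \<squnion> \<Squnion>A"
  using weak_sup_insert by (simp add: eq_is_equal)

lemma join_le_iff:
  "\<lbrakk>a \<in> carrier L; b \<in> carrier L; x \<in> carrier L\<rbrakk> \<Longrightarrow> a \<squnion> b \<sqsubseteq> x \<longleftrightarrow> a \<sqsubseteq> x \<and> b \<sqsubseteq> x"
  by (meson join_closed join_le join_left join_right le_trans)

lemma le_meet_iff:
  "\<lbrakk>a \<in> carrier L; b \<in> carrier L; x \<in> carrier L\<rbrakk> \<Longrightarrow> x \<sqsubseteq> a \<sqinter> b \<longleftrightarrow> x \<sqsubseteq> a \<and> x \<sqsubseteq> b"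
  by (meson meet_closed meet_le meet_left meet_right le_trans)

lemma le_join_disj:
  "\<lbrakk>x \<sqsubseteq> a \<or> x \<sqsubseteq> b; x \<in> carrier L; a \<in> carrier L; b \<in> carrier L\<rbrakk> \<Longrightarrow> x \<sqsubseteq> a \<squnion> b"
  by (meson join_closed join_left join_right le_trans)

lemma meet_le_disj:
  "\<lbrakk>a \<sqsubseteq> x \<or> b \<sqsubseteq> x; x \<in> carrier L; a \<in> carrier L; b \<in> carrier L\<rbrakk> \<Longrightarrow> a \<sqinter> b \<sqsubseteq> x"
  by (meson meet_closed meet_left meet_right le_trans)

text \<open>
  As conditional rewrite rules these four facts make the simplifier prove the inequalities between
  lattice terms that hold in all lattices, backtracking over the two disjunctive ones as in
  Whitman's solution of the word problem for free lattices.
\<close>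

lemmas lattice_le = join_le_iff le_meet_iff le_join_disj meet_le_disj

lemma meet_sup_leI:
  assumes "a \<in> carrier L" "B \<subseteq> carrier L" "y \<in> carrier L" "\<And>b. b \<in> B \<Longrightarrow> a \<sqinter> b \<sqsubseteq> y"
  shows "a \<sqinter> \<Squnion>B \<sqsubseteq> y"
  unfolding meet_sup_distrib[OF assms(1,2)]
  by (rule sup_least) (use assms in auto)

lemma meet_join_distrib:
  assumes "a \<in> carrier L" "b \<in> carrier L" "c \<in> carrier L"
  shows "a \<sqinter> (b \<squnion> c) = (a \<sqinter> b) \<squnion> (a \<sqinter> c)"
  using meet_sup_distrib[of a "{b, c}"] assms by (simp add: join_def)

lemma join_meet_distrib:
  assumes "a \<in> carrier L" "b \<in> carrier L" "c \<in> carrier L"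
  shows "a \<squnion> (b \<sqinter> c) = (a \<squnion> b) \<sqinter> (a \<squnion> c)"
proof (rule le_antisym)
  show "a \<squnion> b \<sqinter> c \<sqsubseteq> (a \<squnion> b) \<sqinter> (a \<squnion> c)"
    using assms by (simp add: lattice_le)
  have "(a \<squnion> b) \<sqinter> (a \<squnion> c) = ((a \<squnion> b) \<sqinter> a) \<squnion> ((a \<squnion> b) \<sqinter> c)"
    using assms by (simp add: meet_join_distrib)
  also have "(a \<squnion> b) \<sqinter> c = (c \<sqinter> a) \<squnion> (c \<sqinter> b)"
    using assms by (subst meet_comm[of L "a \<squnion> b" c]) (simp add: meet_join_distrib)
  also have "((a \<squnion> b) \<sqinter> a) \<squnion> ((c \<sqinter> a) \<squnion> (c \<sqinter> b)) \<sqsubseteq> a \<squnion> b \<sqinter> c"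
    using assms by (simp add: lattice_le)
  finally show "(a \<squnion> b) \<sqinter> (a \<squnion> c) \<sqsubseteq> a \<squnion> b \<sqinter> c" .
qed (use assms in auto)

end

text \<open>
  The locale \<open>frame\<close> admits orders with additional record fields; complements, compact elements and
  subframes are typed for plain orders, hence the restriction.
\<close>

locale gorder_frame = frame L for L :: "'a gorder" (structure)
begin

lemma is_complement_sym: "is_complement L a b \<Longrightarrow> is_complement L b a"
  by (simp add: is_complement_def meet_comm join_comm)

text \<open>
  The meet \<open>b \<sqinter> a'\<close> is the difference of \<open>b\<close> and \<open>a\<close>, the least \<open>x\<close> that has to be joined to \<open>a\<close> in order to cover \<open>b\<close>.
\<close>

lemma meet_complement_le_iff:
  assumes c: "is_complement L a a'" and b: "b \<in> carrier L" and x: "x \<in> carrier L"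
  shows "b \<sqinter> a' \<sqsubseteq> x \<longleftrightarrow> b \<sqsubseteq> a \<squnion> x"
proof -
  have a: "a \<in> carrier L" "a' \<in> carrier L" and m: "a \<sqinter> a' = \<bottom>" and j: "a \<squnion> a' = \<top>"
    using c by (auto simp: is_complement_def)
  show ?thesis
  proof
    assume h: "b \<sqinter> a' \<sqsubseteq> x"
    have "b = b \<sqinter> (a \<squnion> a')"
      using b j le_iff_join[of b \<top>] by simp
    also have "\<dots> = (b \<sqinter> a) \<squnion> (b \<sqinter> a')"
      using a b by (simp add: meet_join_distrib)
    also have "\<dots> \<sqsubseteq> a \<squnion> x"
      using a b x h by (simp add: lattice_le)
    finally show "b \<sqsubseteq> a \<squnion> x" .
  next
    assume h: "b \<sqsubseteq> a \<squnion> x"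
    have "b \<sqinter> a' \<sqsubseteq> a' \<sqinter> (a \<squnion> x)"
      using a b x h by (simp add: lattice_le)
    also have "\<dots> = (a' \<sqinter> a) \<squnion> (a' \<sqinter> x)"
      using a x by (simp add: meet_join_distrib)
    also have "\<dots> \<sqsubseteq> x"
      using a x m by (simp add: lattice_le meet_comm[of L a' a])
    finally show "b \<sqinter> a' \<sqsubseteq> x"
      using a b x by simp
  qed
qed

lemma complement_meet_join:
  assumes "is_complement L a a'" "is_complement L b b'"
  shows "is_complement L (a \<squnion> b) (a' \<sqinter> b')"
proof -
  have cl: "a \<in> carrier L" "a' \<in> carrier L" "b \<in> carrier L" "b' \<in> carrier L"
    using assms by (auto simp: is_complement_def)
  have "(a' \<sqinter> b') \<sqinter> a \<sqsubseteq> \<bottom>"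
    unfolding meet_complement_le_iff[OF is_complement_sym[OF assms(1)]
        meet_closed[OF cl(2,4)] bottom_closed]
    using cl by (simp add: lattice_le)
  moreover have "(a' \<sqinter> b') \<sqinter> b \<sqsubseteq> \<bottom>"
    unfolding meet_complement_le_iff[OF is_complement_sym[OF assms(2)]
        meet_closed[OF cl(2,4)] bottom_closed]
    using cl by (simp add: lattice_le)
  ultimately have "(a \<squnion> b) \<sqinter> (a' \<sqinter> b') \<sqsubseteq> \<bottom>"
    using cl by (simp add: meet_comm[of L "a \<squnion> b"] meet_join_distrib join_le)
  moreover have "\<top> \<sqsubseteq> (a \<squnion> b) \<squnion> (a' \<sqinter> b')"
  proof -
    have "\<top> = (a \<squnion> a') \<sqinter> (b \<squnion> b')"
      using assms by (auto simp: is_complement_def intro!: le_antisym meet_le)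
    also have "\<dots> \<sqsubseteq> ((a \<squnion> b) \<squnion> a') \<sqinter> ((a \<squnion> b) \<squnion> b')"
      using cl by (simp add: lattice_le)
    also have "\<dots> = (a \<squnion> b) \<squnion> (a' \<sqinter> b')"
      using cl by (simp add: join_meet_distrib)
    finally show ?thesis .
  qed
  ultimately show ?thesis
    using cl unfolding is_complement_def by (auto intro!: le_antisym)
qed

text \<open>
  A finite subcover of \<open>insert a A\<close> may or may not contain \<open>a\<close>; joining \<open>a\<close> back on
  covers both cases.
\<close>

lemma compact_le_join_sup:
  assumes b: "compact_element L b" and a: "a \<in> carrier L" and A: "A \<subseteq> carrier L"
    and le: "b \<sqsubseteq> a \<squnion> \<Squnion>A"
  obtains G where "G \<subseteq> A" "finite G" "b \<sqsubseteq> a \<squnion> \<Squnion>G"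
proof -
  have "insert a A \<subseteq> carrier L" "b \<sqsubseteq> \<Squnion>(insert a A)"
    using a A le by (auto simp: sup_insert_eq)
  then obtain F where F: "F \<subseteq> insert a A" "finite F" "b \<sqsubseteq> \<Squnion>F"
    using b unfolding compact_element_def by blast
  let ?G = "F - {a}"
  have FL: "F \<subseteq> carrier L" and G: "?G \<subseteq> carrier L" and bL: "b \<in> carrier L"
    using F a A b by (auto simp: compact_element_def)
  have "\<Squnion>F \<sqsubseteq> a \<squnion> \<Squnion>?G"
    using FL a G by (intro sup_least) (auto simp flip: sup_insert_eq intro!: sup_upper)
  then have "b \<sqsubseteq> a \<squnion> \<Squnion>?G"
    using F(3) FL G a bL by (meson join_closed le_trans sup_closed)
  then show thesis
    using that[of ?G] F by auto
qed

text \<open>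
  If \<open>a \<sqsubseteq> \<Squnion>A\<close>, then \<open>A\<close> together with the complement of \<open>a\<close> covers \<open>\<top>\<close>; dropping the
  complement from a finite subcover leaves a finite cover of \<open>a\<close>.
\<close>

lemma complemented_imp_compact:
  assumes top: "compact_element L \<top>" and c: "is_complement L a a'"
  shows "compact_element L a"
  unfolding compact_element_def
proof (intro conjI allI impI)
  have cl: "a \<in> carrier L" "a' \<in> carrier L" and j: "a' \<squnion> a = \<top>"
    using c by (auto simp: is_complement_def join_comm)
  show "a \<in> carrier L" by fact
  have meet_top: "\<top> \<sqinter> a = a"
    using cl by (intro le_antisym) (simp_all add: lattice_le)
  fix A assume A: "A \<subseteq> carrier L" and le: "a \<sqsubseteq> \<Squnion>A"
  have "\<top> \<sqsubseteq> a' \<squnion> \<Squnion>A"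
    unfolding j[symmetric] using cl A le by (simp add: lattice_le)
  from compact_le_join_sup[OF top cl(2) A this]
  obtain G where G: "G \<subseteq> A" "finite G" "\<top> \<sqsubseteq> a' \<squnion> \<Squnion>G" .
  moreover have "\<Squnion>G \<in> carrier L" using G A by auto
  ultimately have "a \<sqsubseteq> \<Squnion>G"
    using meet_complement_le_iff[OF is_complement_sym[OF c], of \<top> "\<Squnion>G"] meet_top by simp
  with G show "\<exists>F\<subseteq>A. finite F \<and> a \<sqsubseteq> \<Squnion>F" by blast
qed

lemma subframe_generated_subframe:
  assumes "A \<subseteq> carrier L"
  shows "subframe (generated_subframe L A) L"
proof -
  have "subframe (carrier L) L" by (auto simp: subframe_def)
  with assms show ?thesis
    unfolding generated_subframe_def by (auto simp: subframe_def subset_iff)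
qed

end

lemma generated_subframe_least:
  "\<lbrakk>subframe S L; A \<subseteq> S\<rbrakk> \<Longrightarrow> generated_subframe L A \<subseteq> S"
  by (auto simp: generated_subframe_def)

lemma generated_subframe_upper: "A \<subseteq> generated_subframe L A"
  by (auto simp: generated_subframe_def)

locale frame_with_subframe = gorder_frame +
  fixes S :: "'a set"
  assumes subframe: "subframe S L"
begin

abbreviation "N \<equiv> L\<lparr>carrier := S\<rparr>"

lemma S_carrier [simp]: "a \<in> S \<Longrightarrow> a \<in> carrier L"
  and S_subset: "S \<subseteq> carrier L"
  and S_top [simp]: "\<top> \<in> S"
  and S_meet [simp]: "a \<in> S \<Longrightarrow> b \<in> S \<Longrightarrow> a \<sqinter> b \<in> S"
  and S_sup [simp]: "A \<subseteq> S \<Longrightarrow> \<Squnion>A \<in> S"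
  using subframe by (auto simp: subframe_def)

lemma S_bottom [simp]: "\<bottom> \<in> S"
  using S_sup[of "{}"] by (simp add: sup_empty_eq)

lemma S_join [simp]: "a \<in> S \<Longrightarrow> b \<in> S \<Longrightarrow> a \<squnion> b \<in> S"
  by (simp add: join_def)

lemma least_sup_N: "A \<subseteq> S \<Longrightarrow> least N (\<Squnion>A) (Upper N A)"
  using S_subset
  by (intro least_UpperI) (auto 4 4 intro: sup_upper intro!: sup_least simp: Upper_def)

lemma partial_order_N: "partial_order N"
  by unfold_locales (auto simp: eq_is_equal intro: le_trans)

lemma complete_lattice_N: "complete_lattice N"
proof -
  interpret N: partial_order N by (rule partial_order_N)
  show ?thesis
  proof (rule N.complete_latticeI)
    (* Infinite meets in N may differ from those in L, so they are built as joins of lower bounds. *)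
    fix A assume A: "A \<subseteq> carrier N"
    then show "\<exists>s. least N s (Upper N A)" using least_sup_N by auto
    have "greatest N (\<Squnion>{x\<in>S. \<forall>a\<in>A. x \<sqsubseteq> a}) (Lower N A)"
      using A S_subset
      by (intro greatest_LowerI) (auto intro!: sup_upper sup_least simp: Lower_def)
    then show "\<exists>i. greatest N i (Lower N A)" by auto
  qed
qed

lemma sup_N: "A \<subseteq> S \<Longrightarrow> \<Squnion>\<^bsub>N\<^esub>A = \<Squnion>A"
  using complete_lattice.sup_eqI[OF complete_lattice_N least_sup_N] .

lemma meet_N:
  assumes "a \<in> S" "b \<in> S" shows "a \<sqinter>\<^bsub>N\<^esub> b = a \<sqinter> b"
proof -
  have "greatest N (a \<sqinter> b) (Lower N {a, b})"
    using assms by (intro greatest_LowerI) (auto simp: Lower_def meet_left meet_right meet_le)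
  then show ?thesis
    unfolding meet_def[of N] by (rule complete_lattice.inf_eqI[OF complete_lattice_N])
qed

lemma top_N: "\<top>\<^bsub>N\<^esub> = \<top>"
  by (rule complete_lattice.top_eqI[OF complete_lattice_N]) (auto simp: greatest_def)

lemma bottom_N: "\<bottom>\<^bsub>N\<^esub> = \<bottom>"
  by (rule complete_lattice.bottom_eqI[OF complete_lattice_N]) (auto simp: least_def)

lemma frame_N: "frame N"
proof -
  interpret N: complete_lattice N by (rule complete_lattice_N)
  show ?thesis
  proof
    fix a B assume a: "a \<in> carrier N" and B: "B \<subseteq> carrier N"
    have "(\<lambda>b. a \<sqinter>\<^bsub>N\<^esub> b) ` B = (\<lambda>b. a \<sqinter> b) ` B"
      using a B by (auto simp: meet_N intro!: image_cong)
    then show "a \<sqinter>\<^bsub>N\<^esub> \<Squnion>\<^bsub>N\<^esub>B = \<Squnion>\<^bsub>N\<^esub>((\<lambda>b. a \<sqinter>\<^bsub>N\<^esub> b) ` B)"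
      using a B S_subset by (subst (1 2) sup_N) (auto simp: meet_N meet_sup_distrib)
  qed
qed

lemma compact_element_N:
  assumes "a \<in> S" "compact_element L a" shows "compact_element N a"
  unfolding compact_element_def
proof (intro conjI allI impI)
  fix A assume A: "A \<subseteq> carrier N" and le: "a \<sqsubseteq>\<^bsub>N\<^esub> \<Squnion>\<^bsub>N\<^esub>A"
  then have AS: "A \<subseteq> S" "A \<subseteq> carrier L" using S_subset by auto
  then obtain F where "F \<subseteq> A" "finite F" "a \<sqsubseteq> \<Squnion>F"
    using assms le unfolding compact_element_def by (auto simp: sup_N)
  then show "\<exists>F\<subseteq>A. finite F \<and> a \<sqsubseteq>\<^bsub>N\<^esub> \<Squnion>\<^bsub>N\<^esub>F"
    using AS by (intro exI[of _ F]) (auto simp: sup_N)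
qed (use assms in auto)

end


section \<open>Order isomorphisms\<close>

locale order_isomorphism = dom: partial_order L + cod: partial_order K
  for L :: "'a gorder" and K :: "'b gorder" +
  fixes f :: "'a \<Rightarrow> 'b"
  assumes bij: "bij_betw f (carrier L) (carrier K)"
    and le_iff: "\<And>x y. \<lbrakk>x \<in> carrier L; y \<in> carrier L\<rbrakk> \<Longrightarrow> f x \<sqsubseteq>\<^bsub>K\<^esub> f y \<longleftrightarrow> x \<sqsubseteq>\<^bsub>L\<^esub> y"
begin

lemma carrier_K: "carrier K = f ` carrier L"
  using bij by (simp add: bij_betw_def)

lemma least_image: "least L s A \<Longrightarrow> least K (f s) (f ` A)"
  unfolding least_def carrier_K using le_iff by (auto simp: subset_iff)

lemma greatest_image: "greatest L s A \<Longrightarrow> greatest K (f s) (f ` A)"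
  unfolding greatest_def carrier_K using le_iff by (auto simp: subset_iff)

lemma Upper_image:
  assumes "A \<subseteq> carrier L" shows "Upper K (f ` A) = f ` Upper L A"
proof -
  have "Upper L A = {x \<in> carrier L. \<forall>a\<in>A. a \<sqsubseteq>\<^bsub>L\<^esub> x}"
    using assms by (auto simp: Upper_def)
  moreover have "Upper K (f ` A) = {y \<in> f ` carrier L. \<forall>b\<in>f ` A. b \<sqsubseteq>\<^bsub>K\<^esub> y}"
    using assms by (auto simp: Upper_def carrier_K)
  ultimately show ?thesis
    using assms le_iff by (auto simp: subset_iff)
qed

lemma Lower_image:
  assumes "A \<subseteq> carrier L" shows "Lower K (f ` A) = f ` Lower L A"
proof -
  have "Lower L A = {x \<in> carrier L. \<forall>a\<in>A. x \<sqsubseteq>\<^bsub>L\<^esub> a}"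
    using assms by (auto simp: Lower_def)
  moreover have "Lower K (f ` A) = {y \<in> f ` carrier L. \<forall>b\<in>f ` A. y \<sqsubseteq>\<^bsub>K\<^esub> b}"
    using assms by (auto simp: Lower_def carrier_K)
  ultimately show ?thesis
    using assms le_iff by (auto simp: subset_iff)
qed

lemma inverse: "order_isomorphism K L (inv_into (carrier L) f)"
proof unfold_locales
  show "bij_betw (inv_into (carrier L) f) (carrier K) (carrier L)"
    by (rule bij_betw_inv_into[OF bij])
  show "inv_into (carrier L) f x \<sqsubseteq>\<^bsub>L\<^esub> inv_into (carrier L) f y \<longleftrightarrow> x \<sqsubseteq>\<^bsub>K\<^esub> y"
    if "x \<in> carrier K" "y \<in> carrier K" for x y
    using le_iff[of "inv_into (carrier L) f x" "inv_into (carrier L) f y"] that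
    by (simp add: carrier_K inv_into_into f_inv_into_f)
qed

end

locale frame_isomorphism = order_isomorphism L K f + gorder_frame L
  for L :: "'a gorder" and K :: "'b gorder" and f
begin

lemma complete_lattice_codomain: "complete_lattice K"
proof (rule cod.complete_latticeI)
  fix B assume "B \<subseteq> carrier K"
  then obtain A where A: "A \<subseteq> carrier L" "B = f ` A"
    by (auto simp: carrier_K subset_image_iff)
  show "\<exists>s. least K s (Upper K B)"
    using least_image[OF sup_lub[OF A(1)]] A by (auto simp: Upper_image)
  show "\<exists>s. greatest K s (Lower K B)"
    using greatest_image[OF inf_glb[OF A(1)]] A by (auto simp: Lower_image)
qed

lemma image_sup: "A \<subseteq> carrier L \<Longrightarrow> f (\<Squnion>\<^bsub>L\<^esub>A) = \<Squnion>\<^bsub>K\<^esub>(f ` A)"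
  by (rule complete_lattice.sup_eqI[OF complete_lattice_codomain, symmetric])
     (simp add: Upper_image least_image sup_lub)

lemma image_meet:
  assumes "a \<in> carrier L" "b \<in> carrier L"
  shows "f (a \<sqinter>\<^bsub>L\<^esub> b) = f a \<sqinter>\<^bsub>K\<^esub> f b"
  unfolding meet_def
  by (rule complete_lattice.inf_eqI[OF complete_lattice_codomain, symmetric])
     (use assms greatest_image[OF inf_glb[of "{a, b}"]] Lower_image[of "{a, b}"] in simp)

lemma image_top: "f \<top>\<^bsub>L\<^esub> = \<top>\<^bsub>K\<^esub>"
  by (rule complete_lattice.top_eqI[OF complete_lattice_codomain, symmetric])
     (simp add: carrier_K greatest_image top_greatest)

lemma frame_codomain: "frame K"
proof -
  interpret K: complete_lattice K by (rule complete_lattice_codomain)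
  show ?thesis
  proof
    fix c C assume "c \<in> carrier K" "C \<subseteq> carrier K"
    then obtain a A where a: "a \<in> carrier L" "c = f a" and A: "A \<subseteq> carrier L" "C = f ` A"
      by (auto simp: carrier_K subset_image_iff)
    have "c \<sqinter>\<^bsub>K\<^esub> \<Squnion>\<^bsub>K\<^esub>C = f (a \<sqinter>\<^bsub>L\<^esub> \<Squnion>\<^bsub>L\<^esub>A)"
      using a A by (simp add: image_sup image_meet)
    also have "\<dots> = \<Squnion>\<^bsub>K\<^esub>(f ` (\<lambda>b. a \<sqinter>\<^bsub>L\<^esub> b) ` A)"
      using a A by (subst image_sup[symmetric]) (auto simp: meet_sup_distrib)
    also have "f ` (\<lambda>b. a \<sqinter>\<^bsub>L\<^esub> b) ` A = (\<lambda>b. c \<sqinter>\<^bsub>K\<^esub> b) ` C"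
      using a A by (auto simp: image_meet image_image subset_iff intro!: image_cong)
    finally show "c \<sqinter>\<^bsub>K\<^esub> \<Squnion>\<^bsub>K\<^esub>C = \<Squnion>\<^bsub>K\<^esub>((\<lambda>b. c \<sqinter>\<^bsub>K\<^esub> b) ` C)" .
  qed
qed

lemma frame_hom_iso: "frame_hom L K f"
  unfolding frame_hom_def
  using frame_axioms frame_codomain bij image_top image_meet image_sup
  by (auto simp: carrier_K)

lemma inverse_frame: "frame_isomorphism K L (inv_into (carrier L) f)"
proof -
  interpret inv: order_isomorphism K L "inv_into (carrier L) f" by (rule inverse)
  interpret K: frame K by (rule frame_codomain)
  show ?thesis by unfold_locales
qed

end

lemma subframe_image:
  assumes f: "frame_hom L K f" and S: "subframe S L"
  shows "subframe (f ` S) K"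
proof -
  have SL: "S \<subseteq> carrier L" using S by (simp add: subframe_def)
  have "\<Squnion>\<^bsub>K\<^esub>B \<in> f ` S" if "B \<subseteq> f ` S" for B
  proof -
    obtain A where A: "A \<subseteq> S" "B = f ` A" using \<open>B \<subseteq> f ` S\<close> subset_imageE by metis
    then have "\<Squnion>\<^bsub>K\<^esub>B = f (\<Squnion>\<^bsub>L\<^esub>A)" using f SL by (auto simp: frame_hom_def)
    then show ?thesis using S A by (auto simp: subframe_def)
  qed
  moreover have "\<top>\<^bsub>K\<^esub> \<in> f ` S"
    using f S unfolding frame_hom_def subframe_def by (metis imageI)
  moreover have "f a \<sqinter>\<^bsub>K\<^esub> f b \<in> f ` S" if "a \<in> S" "b \<in> S" for a b
    using f S SL that unfolding frame_hom_def subframe_def by (metis imageI subsetD)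
  ultimately show ?thesis
    using f SL unfolding subframe_def by (auto simp: frame_hom_def)
qed

lemma subframe_vimage:
  assumes f: "frame_hom L K f" and T: "subframe T K"
  shows "subframe {x \<in> carrier L. f x \<in> T} L"
proof -
  interpret frame L using f by (simp add: frame_hom_def)
  have "f (\<Squnion>\<^bsub>L\<^esub>A) \<in> T" if "A \<subseteq> {x \<in> carrier L. f x \<in> T}" for A
  proof -
    have "A \<subseteq> carrier L" "f ` A \<subseteq> T" using that by auto
    then show ?thesis using f T by (simp add: frame_hom_def subframe_def)
  qed
  moreover have "A \<subseteq> carrier L" if "A \<subseteq> {x \<in> carrier L. f x \<in> T}" for A
    using that by auto
  ultimately show ?thesis
    using f T by (auto simp: subframe_def frame_hom_def)
qed

text \<open>
  Both inclusions follow from minimality: subframes pull back and push forward along a frame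
  homomorphism.
\<close>

lemma generated_subframe_image:
  assumes f: "frame_hom L K f" and A: "A \<subseteq> carrier L"
  shows "f ` generated_subframe L A = generated_subframe K (f ` A)"
proof
  interpret L: gorder_frame L using f by (simp add: frame_hom_def gorder_frame_def)
  interpret K: gorder_frame K using f by (simp add: frame_hom_def gorder_frame_def)
  have fA: "f ` A \<subseteq> carrier K" using f A by (auto simp: frame_hom_def)
  show "f ` generated_subframe L A \<subseteq> generated_subframe K (f ` A)"
    using generated_subframe_least[OF
        subframe_vimage[OF f K.subframe_generated_subframe[OF fA]], of A]
      A generated_subframe_upper[of "f ` A" K] by auto
  show "generated_subframe K (f ` A) \<subseteq> f ` generated_subframe L A"
    by (intro generated_subframe_least subframe_image[OF f] L.subframe_generated_subframe A
        image_mono generated_subframe_upper)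
qed

lemma biframe_transport:
  fixes M :: "'a biframe_data" and N :: "'b biframe_data"
  assumes M: "biframe M"
    and iso: "order_isomorphism (total_part M) (total_part N) f"
    and first: "first_part N = f ` first_part M"
    and second: "second_part N = f ` second_part M"
  shows "biframe_isomorphic M N"
proof -
  let ?L = "total_part M" and ?K = "total_part N"
  let ?g = "inv_into (carrier ?L) f"
  interpret order_isomorphism ?L ?K f by (rule iso)
  interpret gorder_frame ?L using M by (simp add: biframe_def gorder_frame_def)
  interpret fr: frame_isomorphism ?L ?K f by unfold_locales
  interpret inv: frame_isomorphism ?K ?L ?g by (rule fr.inverse_frame)
  have parts: "first_part M \<subseteq> carrier ?L" "second_part M \<subseteq> carrier ?L"
    using M by (auto simp: biframe_def subframe_def)
  have "f ` carrier ?L = generated_subframe ?K (f ` (first_part M \<union> second_part M))"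
    using generated_subframe_image[OF fr.frame_hom_iso, of "first_part M \<union> second_part M"]
      parts M by (simp add: biframe_def)
  then have N: "biframe N"
    using M subframe_image[OF fr.frame_hom_iso] fr.frame_codomain
    by (simp add: biframe_def first second image_Un carrier_K)
  have gf: "?g (f x) = x" if "x \<in> carrier ?L" for x
    using bij that by (simp add: bij_betw_def)
  have "biframe_hom M N f"
    using M N fr.frame_hom_iso by (simp add: biframe_hom_def first second)
  moreover have "biframe_hom N M ?g"
    using M N inv.frame_hom_iso parts gf
    by (auto simp: biframe_hom_def first second subset_iff)
  moreover have "f (?g y) = y" if "y \<in> carrier ?K" for y
    using that by (simp add: carrier_K f_inv_into_f)
  ultimately show ?thesis
    using gf unfolding biframe_isomorphic_def by blast
qed

section \<open>Congruences induced by elements of an ambient frame\<close>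

context frame_with_subframe
begin

text \<open>
  The pair of inequalities is equivalent to \<open>a \<squnion> x = b \<squnion> x\<close>; in this form each side can be
  matched with \<open>meet_complement_le_iff\<close> directly.
\<close>

definition kernel :: "'a \<Rightarrow> ('a \<times> 'a) set" where
  "kernel x = {(a, b) \<in> S \<times> S. a \<sqsubseteq> b \<squnion> x \<and> b \<sqsubseteq> a \<squnion> x}"

lemma kernel_congruence:
  assumes x: "x \<in> carrier L"
  shows "frame_congruence N (kernel x)"
  unfolding frame_congruence_def
proof (intro conjI)
  have tr: "a \<sqsubseteq> c \<squnion> x" if "a \<sqsubseteq> b \<squnion> x" "b \<sqsubseteq> c \<squnion> x" "a \<in> S" "b \<in> S" "c \<in> S" for a b c
  proof -
    have "b \<squnion> x \<sqsubseteq> c \<squnion> x" using that x by (simp add: lattice_le)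
    then show ?thesis using that x by (meson S_carrier join_closed le_trans)
  qed
  show "equiv (carrier N) (kernel x)"
    using x by (auto simp: kernel_def lattice_le intro!: equivI refl_onI symI transI intro: tr)
  have mt: "a \<sqinter> c \<sqsubseteq> (b \<sqinter> d) \<squnion> x"
    if "a \<sqsubseteq> b \<squnion> x" "c \<sqsubseteq> d \<squnion> x" "a \<in> S" "b \<in> S" "c \<in> S" "d \<in> S" for a b c d
  proof -
    have "a \<sqinter> c \<sqsubseteq> (x \<squnion> b) \<sqinter> (x \<squnion> d)"
      using that x by (simp add: lattice_le join_comm[of L x])
    also have "\<dots> = (b \<sqinter> d) \<squnion> x"
      using that x by (simp add: join_meet_distrib join_comm[of L "b \<sqinter> d"])
    finally show ?thesis .
  qed
  then show "\<forall>(a, b)\<in>kernel x. \<forall>(c, d)\<in>kernel x. (a \<sqinter>\<^bsub>N\<^esub> c, b \<sqinter>\<^bsub>N\<^esub> d) \<in> kernel x"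
    by (auto simp: kernel_def meet_N)
  have sp: "\<Squnion>A \<sqsubseteq> \<Squnion>B \<squnion> x"
    if AB: "A \<subseteq> S" "B \<subseteq> S" and ex: "\<forall>a\<in>A. \<exists>b\<in>B. a \<sqsubseteq> b \<squnion> x" for A B
  proof (rule sup_least)
    fix a assume "a \<in> A"
    then obtain b where b: "b \<in> B" "a \<sqsubseteq> b \<squnion> x" using ex by blast
    have bS: "b \<in> carrier L" "a \<in> carrier L" "\<Squnion>B \<in> carrier L"
      using AB b \<open>a \<in> A\<close> S_subset by auto
    have "b \<sqsubseteq> \<Squnion>B" using AB b S_subset by (intro sup_upper) auto
    then have "b \<squnion> x \<sqsubseteq> \<Squnion>B \<squnion> x"
      using bS x by (simp add: lattice_le)
    then show "a \<sqsubseteq> \<Squnion>B \<squnion> x"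
      using b(2) bS x by (meson join_closed le_trans)
  qed (use AB x S_subset in auto)
  show "\<forall>R\<subseteq>kernel x. (\<Squnion>\<^bsub>N\<^esub>(fst ` R), \<Squnion>\<^bsub>N\<^esub>(snd ` R)) \<in> kernel x"
  proof (intro allI impI)
    fix R assume R: "R \<subseteq> kernel x"
    then have S: "fst ` R \<subseteq> S" "snd ` R \<subseteq> S" by (auto simp: kernel_def)
    have "fst p \<sqsubseteq> snd p \<squnion> x \<and> snd p \<sqsubseteq> fst p \<squnion> x" if "p \<in> R" for p
      using R that by (auto simp: kernel_def)
    then have "\<forall>a\<in>fst ` R. \<exists>b\<in>snd ` R. a \<sqsubseteq> b \<squnion> x"
      "\<forall>b\<in>snd ` R. \<exists>a\<in>fst ` R. b \<sqsubseteq> a \<squnion> x"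
      by blast+
    then have "\<Squnion>(fst ` R) \<sqsubseteq> \<Squnion>(snd ` R) \<squnion> x" "\<Squnion>(snd ` R) \<sqsubseteq> \<Squnion>(fst ` R) \<squnion> x"
      using S by (blast intro: sp)+
    then show "(\<Squnion>\<^bsub>N\<^esub>(fst ` R), \<Squnion>\<^bsub>N\<^esub>(snd ` R)) \<in> kernel x"
      using S by (simp add: kernel_def sup_N)
  qed
qed

lemma congruence_equiv: "frame_congruence N \<theta> \<Longrightarrow> equiv S \<theta>"
  by (simp add: frame_congruence_def)

lemma congruence_refl: "\<lbrakk>frame_congruence N \<theta>; a \<in> S\<rbrakk> \<Longrightarrow> (a, a) \<in> \<theta>"
  by (drule congruence_equiv) (auto elim!: equivE dest: refl_onD)

lemma congruence_sym: "\<lbrakk>frame_congruence N \<theta>; (a, b) \<in> \<theta>\<rbrakk> \<Longrightarrow> (b, a) \<in> \<theta>"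
  by (drule congruence_equiv) (auto elim!: equivE dest: symD)

lemma congruence_trans:
  "\<lbrakk>frame_congruence N \<theta>; (a, b) \<in> \<theta>; (b, c) \<in> \<theta>\<rbrakk> \<Longrightarrow> (a, c) \<in> \<theta>"
  by (drule congruence_equiv) (auto elim!: equivE dest: transD)

lemma congruence_subset: "frame_congruence N \<theta> \<Longrightarrow> \<theta> \<subseteq> S \<times> S"
  by (drule congruence_equiv) (auto elim!: equivE)

lemma congruence_meet:
  assumes "frame_congruence N \<theta>" "(a, b) \<in> \<theta>" "(c, d) \<in> \<theta>"
  shows "(a \<sqinter> c, b \<sqinter> d) \<in> \<theta>"
proof -
  have "a \<in> S" "b \<in> S" "c \<in> S" "d \<in> S"
    using congruence_subset[OF assms(1)] assms by auto
  moreover have "(a \<sqinter>\<^bsub>N\<^esub> c, b \<sqinter>\<^bsub>N\<^esub> d) \<in> \<theta>"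
    using assms unfolding frame_congruence_def by blast
  ultimately show ?thesis by (simp add: meet_N)
qed

lemma congruence_join:
  assumes "frame_congruence N \<theta>" "(a, b) \<in> \<theta>" "(c, d) \<in> \<theta>"
  shows "(a \<squnion> c, b \<squnion> d) \<in> \<theta>"
proof -
  have "a \<in> S" "b \<in> S" "c \<in> S" "d \<in> S"
    using congruence_subset[OF assms(1)] assms by auto
  moreover have "(\<Squnion>\<^bsub>N\<^esub>(fst ` {(a, b), (c, d)}), \<Squnion>\<^bsub>N\<^esub>(snd ` {(a, b), (c, d)})) \<in> \<theta>"
    using assms(1)[unfolded frame_congruence_def, THEN conjunct2, THEN conjunct2, rule_format,
        of "{(a, b), (c, d)}"] assms(2,3) by simp
  ultimately show ?thesis by (simp add: join_def sup_N)
qed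

text \<open>
  A congruence that identifies \<open>\<bottom>\<close> with \<open>a\<close> identifies every \<open>y\<close> with \<open>y \<squnion> a\<close>, hence any two
  elements that become equal after joining \<open>a\<close>.
\<close>

lemma nabla_eq_kernel:
  assumes "a \<in> S" shows "nabla N a = kernel a"
proof -
  have "(\<bottom>, a) \<in> kernel a"
    using assms by (simp add: kernel_def lattice_le)
  moreover have "kernel a \<subseteq> \<theta>" if \<theta>: "frame_congruence N \<theta>" "(\<bottom>, a) \<in> \<theta>" for \<theta>
  proof clarify
    fix b c assume "(b, c) \<in> kernel a"
    then have bc: "b \<in> S" "c \<in> S" and le: "b \<sqsubseteq> c \<squnion> a" "c \<sqsubseteq> b \<squnion> a"
      by (auto simp: kernel_def)
    have absorb: "(y, y \<squnion> a) \<in> \<theta>" if "y \<in> S" for y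
    proof -
      have "y \<squnion> \<bottom> = y" using that by (intro le_antisym) (simp_all add: lattice_le)
      then show ?thesis
        using congruence_join[OF \<theta>(1) congruence_refl[OF \<theta>(1) that] \<theta>(2)] by simp
    qed
    have "b \<squnion> a = c \<squnion> a"
      using bc assms le by (intro le_antisym) (simp_all add: lattice_le)
    then show "(b, c) \<in> \<theta>"
      using absorb[OF bc(1)] absorb[OF bc(2)] congruence_sym[OF \<theta>(1)]
        congruence_trans[OF \<theta>(1)] by metis
  qed
  ultimately show ?thesis
    using kernel_congruence[of a] assms
    unfolding nabla_def generated_congruence_def bottom_N by auto
qed

text \<open>
  Dually, a congruence that identifies \<open>a\<close> with \<open>\<top>\<close> identifies every \<open>y\<close> with \<open>y \<sqinter> a\<close>; and
  becoming equal after joining the complement of \<open>a\<close> means having equal meets with \<open>a\<close>.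
\<close>

lemma delta_eq_kernel:
  assumes "a \<in> S" and c: "is_complement L a a'" shows "delta N a = kernel a'"
proof -
  have a': "a' \<in> carrier L" using c by (simp add: is_complement_def)
  have kernel_iff: "(b, d) \<in> kernel a' \<longleftrightarrow> b \<in> S \<and> d \<in> S \<and> b \<sqinter> a \<sqsubseteq> d \<and> d \<sqinter> a \<sqsubseteq> b" for b d
    using meet_complement_le_iff[OF is_complement_sym[OF c]] a'
    by (auto simp: kernel_def join_comm[of L _ a'])
  have "(a, \<top>) \<in> kernel a'"
    using assms by (simp add: kernel_iff lattice_le)
  moreover have "kernel a' \<subseteq> \<theta>" if \<theta>: "frame_congruence N \<theta>" "(a, \<top>) \<in> \<theta>" for \<theta>
  proof clarify
    fix b d assume "(b, d) \<in> kernel a'"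
    then have bd: "b \<in> S" "d \<in> S" and le: "b \<sqinter> a \<sqsubseteq> d" "d \<sqinter> a \<sqsubseteq> b"
      by (auto simp: kernel_iff)
    have absorb: "(y \<sqinter> a, y) \<in> \<theta>" if "y \<in> S" for y
    proof -
      have "y \<sqinter> \<top> = y" using that by (intro le_antisym) (simp_all add: lattice_le)
      then show ?thesis
        using congruence_meet[OF \<theta>(1) congruence_refl[OF \<theta>(1) that] \<theta>(2)] by simp
    qed
    have "b \<sqinter> a = d \<sqinter> a"
      using bd assms le by (intro le_antisym) (simp_all add: lattice_le)
    then show "(b, d) \<in> \<theta>"
      using absorb[OF bd(1)] absorb[OF bd(2)] congruence_sym[OF \<theta>(1)]
        congruence_trans[OF \<theta>(1)] by metis
  qed
  ultimately show ?thesis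
    using kernel_congruence[OF a']
    unfolding delta_def generated_congruence_def top_N by auto
qed

end

section \<open>Frames generated by a subframe and its complements\<close>

locale complemented_subframe = frame_with_subframe +
  assumes complemented: "a \<in> S \<Longrightarrow> \<exists>a'. is_complement L a a'"
begin

definition complements :: "'a set" where
  "complements = {a'. \<exists>a\<in>S. is_complement L a a'}"

definition differences :: "'a set" where
  "differences = {b \<sqinter> a' | a b a'. a \<in> S \<and> b \<in> S \<and> is_complement L a a'}"

lemma differences_subset: "differences \<subseteq> carrier L"
  by (auto simp: differences_def is_complement_def)

lemma differences_meet:
  assumes "u \<in> differences" "v \<in> differences" shows "u \<sqinter> v \<in> differences"
proof -
  obtain a b a' c d c' where
    u: "u = b \<sqinter> a'" "a \<in> S" "b \<in> S" "is_complement L a a'" and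
    v: "v = d \<sqinter> c'" "c \<in> S" "d \<in> S" "is_complement L c c'"
    using assms unfolding differences_def by blast
  have cl: "a' \<in> carrier L" "c' \<in> carrier L" "b \<in> carrier L" "d \<in> carrier L"
    using u v by (auto simp: is_complement_def)
  then have "u \<sqinter> v = (b \<sqinter> d) \<sqinter> (a' \<sqinter> c')"
    unfolding u(1) v(1) by (intro le_antisym) (simp_all add: lattice_le)
  moreover have "a \<squnion> c \<in> S" "b \<sqinter> d \<in> S"
    using u v by simp_all
  moreover have "is_complement L (a \<squnion> c) (a' \<sqinter> c')"
    by (rule complement_meet_join[OF u(4) v(4)])
  ultimately show ?thesis
    unfolding differences_def by blast
qed

text \<open>
  The joins of differences form a subframe, because differences are closed under binary meets. It
  contains \<open>S\<close> and the complements, since \<open>a = a \<sqinter> \<bottom>'\<close> and \<open>a' = \<top> \<sqinter> a'\<close>, and therefore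
  is all of \<open>L\<close>.
\<close>

lemma sup_of_differences:
  assumes gen: "generated_subframe L (S \<union> generated_subframe L complements) = carrier L"
    and x: "x \<in> carrier L"
  shows "x = \<Squnion>{u \<in> differences. u \<sqsubseteq> x}"
proof -
  define D where "D x = {u \<in> differences. u \<sqsubseteq> x}" for x
  define T where "T = {x \<in> carrier L. x \<sqsubseteq> \<Squnion>(D x)}"
  have D: "D x \<subseteq> carrier L" for x using differences_subset by (auto simp: D_def)
  have D_le: "\<Squnion>(D x) \<sqsubseteq> x" if "x \<in> carrier L" for x
    using that D by (intro sup_least) (auto simp: D_def)
  have diff: "u \<in> T" if "u \<in> differences" for u
    using that differences_subset D unfolding T_def by (auto simp: D_def intro!: sup_upper)
  have bt: "is_complement L \<bottom> \<top>"
    by (auto simp: is_complement_def intro!: le_antisym simp: lattice_le)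
  have T1: "S \<subseteq> T"
  proof
    fix a assume "a \<in> S"
    then have "a = a \<sqinter> \<top>" by (intro le_antisym) (simp_all add: lattice_le)
    then show "a \<in> T"
      using \<open>a \<in> S\<close> bt S_bottom by (intro diff) (unfold differences_def, blast)
  qed
  have T2: "complements \<subseteq> T"
  proof
    fix a' assume "a' \<in> complements"
    then obtain a where a: "a \<in> S" "is_complement L a a'" by (auto simp: complements_def)
    then have "a' \<in> carrier L" by (simp add: is_complement_def)
    then have "a' = \<top> \<sqinter> a'" by (intro le_antisym) (simp_all add: lattice_le)
    then show "a' \<in> T"
      using a S_top by (intro diff) (unfold differences_def, blast)
  qed
  have T: "subframe T L"
    unfolding subframe_def
  proof (intro conjI ballI allI impI)
    show "T \<subseteq> carrier L" by (auto simp: T_def)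
    show "\<top> \<in> T" using T1 S_top by blast
  next
    fix x y assume xy: "x \<in> T" "y \<in> T"
    then have cl: "x \<in> carrier L" "y \<in> carrier L" by (auto simp: T_def)
    let ?z = "\<Squnion>(D (x \<sqinter> y))"
    have z: "?z \<in> carrier L" using D by simp
    have *: "u \<sqinter> v \<sqsubseteq> ?z" if "u \<in> D x" "v \<in> D y" for u v
      using that cl D differences_meet differences_subset
      by (intro sup_upper) (auto simp: D_def lattice_le subset_iff)
    have "u \<sqinter> y \<sqsubseteq> ?z" if u: "u \<in> D x" for u
    proof -
      have "u \<in> carrier L" using u D by blast
      then have "u \<sqinter> \<Squnion>(D y) \<sqsubseteq> ?z"
        using * u D z by (intro meet_sup_leI) auto
      moreover have "y = \<Squnion>(D y)"
        using xy cl D_le D by (intro le_antisym) (auto simp: T_def)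
      ultimately show ?thesis by simp
    qed
    then have "y \<sqinter> \<Squnion>(D x) \<sqsubseteq> ?z"
      using D z cl by (intro meet_sup_leI) (auto simp: meet_comm[of L y])
    moreover have "x = \<Squnion>(D x)"
      using xy cl D_le D by (intro le_antisym) (auto simp: T_def)
    ultimately show "x \<sqinter> y \<in> T"
      using cl by (simp add: T_def meet_comm[of L x])
  next
    fix A assume A: "A \<subseteq> T"
    then have AL: "A \<subseteq> carrier L" by (auto simp: T_def)
    have "x \<sqsubseteq> \<Squnion>(D (\<Squnion>A))" if "x \<in> A" for x
    proof -
      have "\<Squnion>(D x) \<sqsubseteq> \<Squnion>(D (\<Squnion>A))"
      proof (rule sup_least)
        fix u assume u: "u \<in> D x"
        have "u \<sqsubseteq> \<Squnion>A"
          using u that AL D by (auto simp: D_def intro!: le_trans[OF _ sup_upper[OF AL that]])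
        then show "u \<sqsubseteq> \<Squnion>(D (\<Squnion>A))"
          using u D by (intro sup_upper) (auto simp: D_def)
      qed (use D in auto)
      then show ?thesis
        using that A AL D by (auto simp: T_def intro: le_trans)
    qed
    then show "\<Squnion>A \<in> T"
      using AL D by (auto simp: T_def intro!: sup_least)
  qed
  have "carrier L \<subseteq> T"
    using generated_subframe_least[OF T] T1 T2 gen by (metis Un_least)
  then show ?thesis
    using x D_le D by (intro le_antisym) (auto simp: T_def D_def)
qed

text \<open>
  A difference \<open>b \<sqinter> a'\<close> lies below \<open>x\<close> exactly when \<open>(a, a \<squnion> b) \<in> kernel x\<close>, so the kernel
  determines the differences below \<open>x\<close> and with them \<open>x\<close>.
\<close>

lemma kernel_subset_iff:
  assumes gen: "generated_subframe L (S \<union> generated_subframe L complements) = carrier L"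
    and x: "x \<in> carrier L" and y: "y \<in> carrier L"
  shows "kernel x \<subseteq> kernel y \<longleftrightarrow> x \<sqsubseteq> y"
proof
  assume "x \<sqsubseteq> y"
  have "b \<sqsubseteq> a \<squnion> y" if "b \<sqsubseteq> a \<squnion> x" "a \<in> S" "b \<in> S" for a b
  proof -
    have "a \<squnion> x \<sqsubseteq> a \<squnion> y"
      using that x y \<open>x \<sqsubseteq> y\<close> by (simp add: lattice_le)
    then show ?thesis using that x y by (meson S_carrier join_closed le_trans)
  qed
  then show "kernel x \<subseteq> kernel y" by (auto simp: kernel_def)
next
  assume sub: "kernel x \<subseteq> kernel y"
  have "u \<sqsubseteq> y" if u: "u \<in> differences" "u \<sqsubseteq> x" for u
  proof -
    obtain a b a' where ab: "u = b \<sqinter> a'" "a \<in> S" "b \<in> S" "is_complement L a a'"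
      using u unfolding differences_def by blast
    have "b \<sqsubseteq> a \<squnion> x" using u ab x meet_complement_le_iff[of a a' b x] by simp
    then have "(a, a \<squnion> b) \<in> kernel x"
      using ab x by (simp add: kernel_def lattice_le)
    then have "a \<squnion> b \<sqsubseteq> a \<squnion> y" using sub by (auto simp: kernel_def)
    then have "b \<sqsubseteq> a \<squnion> y"
      using ab y by (meson S_carrier join_closed join_right le_trans)
    then show ?thesis using ab y meet_complement_le_iff[of a a' b y] by simp
  qed
  then have "\<Squnion>{u \<in> differences. u \<sqsubseteq> x} \<sqsubseteq> y"
    using differences_subset y by (intro sup_least) auto
  then show "x \<sqsubseteq> y" using sup_of_differences[OF gen x] by simp
qed

text \<open>
  If \<open>kernel x\<close> is to contain \<open>(c, d)\<close>, then \<open>d \<sqinter> c'\<close> must lie below \<open>x\<close>; the residual of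
  \<open>\<theta>\<close> collects these necessary lower bounds. Its join inverts \<open>kernel\<close>.
\<close>

definition residual :: "('a \<times> 'a) set \<Rightarrow> 'a set" where
  "residual \<theta> = {d \<sqinter> c' | c d c'. (c, d) \<in> \<theta> \<and> is_complement L c c'}"

text \<open>
  Modulo \<open>\<theta>\<close>, the hypothesis says that \<open>b\<close> is below \<open>a\<close>. To remove one element \<open>d \<sqinter> c'\<close>
  from \<open>F\<close>, the induction hypothesis is applied twice. First to \<open>a \<squnion> d\<close> and \<open>b\<close>, because
  \<open>d \<sqinter> c' \<sqsubseteq> d\<close>; then to \<open>a\<close> and \<open>b \<sqinter> c\<close>, because \<open>d \<sqinter> c'\<close> is disjoint from \<open>c\<close>. As
  \<open>c\<close> and \<open>d\<close> are congruent, the two conclusions combine to the chain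

  \<open>a \<sim> a \<squnion> (b \<sqinter> c) = (a \<squnion> c) \<sqinter> (a \<squnion> b) \<sim> (a \<squnion> d) \<sqinter> (a \<squnion> b) \<sim> a \<squnion> b\<close>.
\<close>

lemma congruence_of_le_finite_sup:
  assumes \<theta>: "frame_congruence N \<theta>" and "finite F" "F \<subseteq> residual \<theta>"
    and "a \<in> S" "b \<in> S" "b \<sqsubseteq> a \<squnion> \<Squnion>F"
  shows "(a, a \<squnion> b) \<in> \<theta>"
  using assms(2-)
proof (induction F arbitrary: a b rule: finite_induct)
  case empty
  then have "a \<squnion> \<bottom> = a"
    by (intro le_antisym) (simp_all add: lattice_le)
  with empty have "a \<squnion> b = a"
    by (intro le_antisym) (simp_all add: lattice_le sup_empty_eq)
  then show ?case using congruence_refl[OF \<theta>] empty by simp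
next
  case (insert u F)
  obtain c d c' where u: "u = d \<sqinter> c'" "(c, d) \<in> \<theta>" "is_complement L c c'"
    using insert.prems unfolding residual_def by blast
  have cd: "c \<in> S" "d \<in> S" "c' \<in> carrier L"
    using u congruence_subset[OF \<theta>] by (auto simp: is_complement_def)
  have ab: "a \<in> S" "b \<in> S" by fact+
  have FL: "F \<subseteq> carrier L"
    using insert.prems congruence_subset[OF \<theta>] by (force simp: residual_def is_complement_def)
  define s where "s = \<Squnion>F"
  have s: "s \<in> carrier L" using FL by (simp add: s_def)
  have b_le: "b \<sqsubseteq> a \<squnion> (u \<squnion> s)"
    using insert.prems FL cd u by (simp add: sup_insert_eq s_def)
  have "a \<squnion> (u \<squnion> s) \<sqsubseteq> (a \<squnion> d) \<squnion> s"
    unfolding u using ab cd s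
    by (simp add: lattice_le)
  then have "b \<sqsubseteq> (a \<squnion> d) \<squnion> s"
    using b_le ab cd s u by (meson S_carrier join_closed le_trans meet_closed)
  then have 1: "(a \<squnion> d, (a \<squnion> d) \<squnion> b) \<in> \<theta>"
    using insert.IH insert.prems ab cd by (simp add: s_def)
  have "a \<squnion> (u \<squnion> s) \<sqsubseteq> c' \<squnion> (a \<squnion> s)"
    unfolding u using ab cd s
    by (simp add: lattice_le)
  then have "b \<sqsubseteq> c' \<squnion> (a \<squnion> s)"
    using b_le ab cd s u by (meson S_carrier join_closed le_trans meet_closed)
  then have "b \<sqinter> c \<sqsubseteq> a \<squnion> s"
    using meet_complement_le_iff[OF is_complement_sym[OF u(3)], of b "a \<squnion> s"] ab s by simp
  then have "(a, a \<squnion> (b \<sqinter> c)) \<in> \<theta>"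
    using insert.IH insert.prems ab cd by (simp add: s_def)
  then have 2: "(a, (a \<squnion> c) \<sqinter> (a \<squnion> b)) \<in> \<theta>"
    using ab cd by (simp add: join_meet_distrib meet_comm[of L "a \<squnion> c"])
  have "(a \<squnion> c, a \<squnion> d) \<in> \<theta>"
    using congruence_join[OF \<theta> congruence_refl[OF \<theta>] u(2)] ab by simp
  then have 3: "((a \<squnion> c) \<sqinter> (a \<squnion> b), (a \<squnion> d) \<sqinter> (a \<squnion> b)) \<in> \<theta>"
    using congruence_meet[OF \<theta> _ congruence_refl[OF \<theta>]] ab by simp
  have "((a \<squnion> d) \<sqinter> (a \<squnion> b), ((a \<squnion> d) \<squnion> b) \<sqinter> (a \<squnion> b)) \<in> \<theta>"
    using congruence_meet[OF \<theta> 1 congruence_refl[OF \<theta>]] ab by simp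
  moreover have "((a \<squnion> d) \<squnion> b) \<sqinter> (a \<squnion> b) = a \<squnion> b"
    using ab cd
    by (intro le_antisym) (simp_all add: lattice_le)
  ultimately show ?case
    using 2 3 congruence_trans[OF \<theta>] by metis
qed

text \<open>
  The elements of \<open>S\<close> are compact, so \<open>b \<sqsubseteq> a \<squnion> x\<close> involves only finitely many members of the
  residual; without compactness the kernel of the join could be strictly larger than \<open>\<theta>\<close>.
\<close>

lemma kernel_sup_residual:
  assumes \<theta>: "frame_congruence N \<theta>" and top: "compact_element L \<top>"
  shows "kernel (\<Squnion>(residual \<theta>)) = \<theta>"
proof -
  let ?x = "\<Squnion>(residual \<theta>)"
  have R: "residual \<theta> \<subseteq> carrier L"
    using congruence_subset[OF \<theta>] by (force simp: residual_def is_complement_def)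
  then have x: "?x \<in> carrier L" by simp
  have le: "d \<sqsubseteq> c \<squnion> ?x" if "(c, d) \<in> \<theta>" for c d
  proof -
    have cd: "c \<in> S" "d \<in> S" using that congruence_subset[OF \<theta>] by auto
    obtain c' where c': "is_complement L c c'" using complemented cd by blast
    have "d \<sqinter> c' \<sqsubseteq> ?x"
      using R that c' by (intro sup_upper) (auto simp: residual_def)
    then show ?thesis using meet_complement_le_iff[OF c'] cd x by simp
  qed
  have collapse: "(a, a \<squnion> b) \<in> \<theta>" if ab: "a \<in> S" "b \<in> S" and b: "b \<sqsubseteq> a \<squnion> ?x" for a b
  proof -
    obtain b' where "is_complement L b b'" using complemented ab by blast
    then have "compact_element L b" by (rule complemented_imp_compact[OF top])
    then obtain G where G: "G \<subseteq> residual \<theta>" "finite G" "b \<sqsubseteq> a \<squnion> \<Squnion>G"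
      using compact_le_join_sup[OF _ S_carrier[OF ab(1)] R b] by blast
    then show ?thesis
      using congruence_of_le_finite_sup[OF \<theta>, of G a b] ab by simp
  qed
  show ?thesis
  proof
    show "\<theta> \<subseteq> kernel ?x"
      using congruence_subset[OF \<theta>] le congruence_sym[OF \<theta>] by (auto simp: kernel_def)
    show "kernel ?x \<subseteq> \<theta>"
    proof clarify
      fix a b assume "(a, b) \<in> kernel ?x"
      then have ab: "a \<in> S" "b \<in> S" "b \<sqsubseteq> a \<squnion> ?x" "a \<sqsubseteq> b \<squnion> ?x" by (auto simp: kernel_def)
      then have "(a, a \<squnion> b) \<in> \<theta>" "(b, a \<squnion> b) \<in> \<theta>"
        using collapse[of a b] collapse[of b a] by (auto simp: join_comm[of L b])
      then show "(a, b) \<in> \<theta>"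
        using congruence_sym[OF \<theta>] congruence_trans[OF \<theta>] by blast
    qed
  qed
qed

lemma kernel_order_isomorphism:
  assumes gen: "generated_subframe L (S \<union> generated_subframe L complements) = carrier L"
    and top: "compact_element L \<top>"
  shows "order_isomorphism L (congruence_frame N) kernel"
proof -
  interpret C: partial_order "congruence_frame N"
    by unfold_locales (auto simp: congruence_frame_def)
  show ?thesis
  proof
    show iff: "kernel x \<sqsubseteq>\<^bsub>congruence_frame N\<^esub> kernel y \<longleftrightarrow> x \<sqsubseteq> y"
      if "x \<in> carrier L" "y \<in> carrier L" for x y
      using kernel_subset_iff[OF gen that] by (simp add: congruence_frame_def)
    have "inj_on kernel (carrier L)"
    proof (rule inj_onI)
      fix x y assume xy: "x \<in> carrier L" "y \<in> carrier L" "kernel x = kernel y"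
      then have "x \<sqsubseteq> y" "y \<sqsubseteq> x"
        using kernel_subset_iff[OF gen xy(1,2)] kernel_subset_iff[OF gen xy(2,1)] by blast+
      with xy show "x = y" by (intro le_antisym)
    qed
    moreover have "\<theta> \<in> kernel ` carrier L" if "frame_congruence N \<theta>" for \<theta>
    proof
      show "\<theta> = kernel (\<Squnion>(residual \<theta>))" using kernel_sup_residual[OF that top] by simp
      show "\<Squnion>(residual \<theta>) \<in> carrier L"
        using congruence_subset[OF that]
        by (intro sup_closed) (force simp: residual_def is_complement_def)
    qed
    ultimately show "bij_betw kernel (carrier L) (carrier (congruence_frame N))"
      using kernel_congruence by (auto simp: bij_betw_def congruence_frame_def)
  qed
qed

end

section \<open>Compact strictly zero-dimensional biframes\<close>

theorem mainTheorem11: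
  fixes M :: "'a biframe_data"
  assumes "compact_biframe M"
    and "strictly_zero_dimensional M"
  shows "\<exists>N :: 'a gorder. noetherian_frame N \<and> biframe_isomorphic M (congruence_biframe N)"
proof -
  let ?L = "total_part M" and ?S = "first_part M"
  have M: "biframe M" and top: "compact_element ?L \<top>\<^bsub>?L\<^esub>"
    using assms(1) by (auto simp: compact_biframe_def compact_frame_def)
  interpret L: frame ?L using M by (simp add: biframe_def)
  interpret complemented_subframe ?L ?S
    using M assms(2) by unfold_locales (auto simp: biframe_def strictly_zero_dimensional_def)
  have second: "second_part M = generated_subframe ?L complements"
    using assms(2) by (simp add: strictly_zero_dimensional_def complements_def)
  have gen: "generated_subframe ?L (?S \<union> generated_subframe ?L complements) = carrier ?L"
    using M by (simp add: biframe_def second)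
  interpret iso: order_isomorphism ?L "congruence_frame N" kernel
    by (rule kernel_order_isomorphism[OF gen top])
  interpret fr: frame_isomorphism ?L "congruence_frame N" kernel by unfold_locales
  have "noetherian_frame N"
    unfolding noetherian_frame_def
    using frame_N complemented complemented_imp_compact[OF top] compact_element_N by auto
  moreover have "biframe_isomorphic M (congruence_biframe N)"
  proof (rule biframe_transport[OF M])
    show "order_isomorphism ?L (total_part (congruence_biframe N)) kernel"
      using iso.order_isomorphism_axioms by (simp add: congruence_biframe_def)
    show "first_part (congruence_biframe N) = kernel ` first_part M"
      by (auto simp: congruence_biframe_def nabla_eq_kernel)
    have "delta N ` ?S = kernel ` complements"
    proof
      show "delta N ` ?S \<subseteq> kernel ` complements"
        using complemented delta_eq_kernel by (fastforce simp: complements_def)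
      show "kernel ` complements \<subseteq> delta N ` ?S"
        using delta_eq_kernel by (fastforce simp: complements_def)
    qed
    moreover have "complements \<subseteq> carrier ?L"
      by (auto simp: complements_def is_complement_def)
    ultimately show "second_part (congruence_biframe N) = kernel ` second_part M"
      using generated_subframe_image[OF fr.frame_hom_iso, of complements]
      by (simp add: congruence_biframe_def second)
  qed
  ultimately show ?thesis by blast
qed

end
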